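(* Let $\mathrm{Abs}:[0,1]\times[0,1]\to[0,1]$ be $\mathrm{Abs}(x,y)=|x-y|$. Then $\bar{\mathrm{R}}_\varepsilon(\mathrm{Abs})\le\tilde{O}(1/\varepsilon^{2/5})$.
   Context: Distributed estimation: Alice holds a probability distribution $p$ on $[0,1]$, Bob a probability distribution $q$ on $[0,1]$, and they must output an estimate within additive error $\varepsilon$ of $\mathbb{E}_{x\sim p,y\sim q}[|x-y|]$. $\bar{\mathrm{R}}_\varepsilon(f)$ is the minimum worst-case communication (in bits) of a shared-randomness randomized protocol succeeding with probability at least $2/3$ on every input pair. $\tilde{O}$ hides polylogarithmic factors in $1/\varepsilon$ only. *)

theory Defs
  imports "HOL-Probability.Probability"
begin

text \<open>Deterministic two-party protocol trees. At an inner node the named player sends one bit,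
  computed from that player's own input; a leaf carries the output. The output is thus determined
  by the transcript, so both players know it.\<close>

datatype ('a, 'b) protocol =
    Output real
  | Alice "'a \<Rightarrow> bool" "('a, 'b) protocol" "('a, 'b) protocol"
  | Bob "'b \<Rightarrow> bool" "('a, 'b) protocol" "('a, 'b) protocol"

primrec run :: "('a, 'b) protocol \<Rightarrow> 'a \<Rightarrow> 'b \<Rightarrow> real" where
  "run (Output v) a b = v"
| "run (Alice m P Q) a b = (if m a then run P a b else run Q a b)"
| "run (Bob m P Q) a b = (if m b then run P a b else run Q a b)"

primrec depth :: "('a, 'b) protocol \<Rightarrow> nat" where
  "depth (Output v) = 0"
| "depth (Alice m P Q) = Suc (max (depth P) (depth Q))"
| "depth (Bob m P Q) = Suc (max (depth P) (depth Q))"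

text \<open>A shared-randomness protocol is a probability distribution over deterministic protocols.
  The players' inputs are themselves probability measures \<open>p\<close> on \<open>X\<close> and \<open>q\<close> on \<open>Y\<close>; in the
  protocol tree each is an opaque input, so a message may depend on it arbitrarily.\<close>

definition estimates ::
  "real \<Rightarrow> 'x measure \<Rightarrow> 'y measure \<Rightarrow> ('x \<Rightarrow> 'y \<Rightarrow> real) \<Rightarrow>
    ('x measure, 'y measure) protocol measure \<Rightarrow> bool" where
  "estimates \<epsilon> X Y f M \<longleftrightarrow>
     prob_space M \<and>
     (\<forall>p \<in> space (prob_algebra X). \<forall>q \<in> space (prob_algebra Y).
        let good = {P \<in> space M.
              \<bar>run P p q - (\<integral>(x, y). f x y \<partial>(p \<Otimes>\<^sub>M q))\<bar> \<le> \<epsilon>}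
        in good \<in> sets M \<and> measure M good \<ge> 2/3)"

definition worst_case_cost :: "('a, 'b) protocol measure \<Rightarrow> enat" where
  "worst_case_cost M = (SUP P \<in> space M. enat (depth P))"

text \<open>The infimum over \<open>enat\<close> is attained if some protocol exists, and is \<open>\<infinity>\<close> otherwise.\<close>

definition R_shared ::
  "real \<Rightarrow> 'x measure \<Rightarrow> 'y measure \<Rightarrow> ('x \<Rightarrow> 'y \<Rightarrow> real) \<Rightarrow> enat" where
  "R_shared \<epsilon> X Y f = (INF M \<in> {M. estimates \<epsilon> X Y f M}. worst_case_cost M)"

definition unit_borel :: "real measure" where
  "unit_borel = restrict_space borel {0..1}"

definition Abs :: "real \<Rightarrow> real \<Rightarrow> real" where
  "Abs x y = \<bar>x - y\<bar>"

text \<open>Soft-O in the error parameter, uniformly over \<open>0 < \<epsilon> < 1\<close>. The polylogarithmic factor is a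
  power of \<open>log (2/\<epsilon>) = 1 + log (1/\<epsilon>)\<close>, which unlike \<open>log (1/\<epsilon>)\<close> stays at least \<open>1\<close> as \<open>\<epsilon>\<close>
  approaches \<open>1\<close>.\<close>

definition soft_O :: "(real \<Rightarrow> real) \<Rightarrow> (real \<Rightarrow> enat) set" where
  "soft_O g = {R. \<exists>C::real. \<exists>k::nat. \<forall>\<epsilon> \<in> {0<..<1}.
     ereal_of_enat (R \<epsilon>) \<le> ereal (C * g \<epsilon> * log 2 (2 / \<epsilon>) ^ k)}"

end

theory Submission
  imports Defs
begin

text \<open>Write \<open>F\<close>, \<open>G\<close> for the distribution functions of \<open>p\<close>, \<open>q\<close>. Then
  \<open>E|x - y| = \<integral>F + \<integral>G - 2 \<integral>F G\<close>, where the first two terms are known to one player each.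
  As \<open>F\<close> is monotone, rounding its values down to multiples of \<open>\<epsilon> powr (2/5)\<close> gives a step function
  \<open>F'\<close> that is described by \<open>O(1 / \<epsilon> powr (2/5))\<close> breakpoints; likewise \<open>G'\<close>. Once the players have
  exchanged \<open>F'\<close> and \<open>G'\<close>, in \<open>\<integral>F G = \<integral>F' G + \<integral>(F - F') G' + \<integral>(F - F') (G - G')\<close> each of the first
  two terms is computed by a single player. The integrand of the last one is at most
  \<open>\<epsilon> powr (4/5)\<close>, so by Chebyshev's inequality averaging it over
  \<open>O(\<epsilon> powr (8/5) / \<epsilon>\<^sup>2) = O(1 / \<epsilon> powr (2/5))\<close> shared random points estimates it within \<open>O(\<epsilon>)\<close>.
  Replacing \<open>[0,1]\<close> by a grid of \<open>N = O(1 / \<epsilon>)\<close> points and \<open>F\<close>, \<open>G\<close> by integer multiples of \<open>1 / N\<close>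
  makes every message a natural number of \<open>O(log (1 / \<epsilon>))\<close> bits.\<close>

section \<open>Protocols exchanging words\<close>

lemma split_set_pow2:
  assumes "finite S" "card S \<le> 2 ^ Suc w"
  obtains S1 S2 where "S = S1 \<union> S2" "finite S1" "finite S2" "card S1 \<le> 2 ^ w" "card S2 \<le> 2 ^ w"
proof -
  obtain T where T: "T \<subseteq> S" "card T = card S div 2" "finite T"
    by (meson div_le_dividend obtain_subset_with_card_n)
  show thesis
  proof (rule that)
    show "S = T \<union> (S - T)" using T by auto
    show "card T \<le> 2 ^ w" using T assms by simp
    have "card (S - T) = card S - card S div 2" using T by (simp add: card_Diff_subset)
    then show "card (S - T) \<le> 2 ^ w" using assms by simp
  qed (use T assms in auto)
qed

text \<open>Binary search: each bit tells which half of the remaining candidates contains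
  \<open>h a\<close>, so after \<open>w\<close> bits one candidate \<open>x\<close> is left and the
  tree goes on as \<open>c x\<close>. Nothing is claimed for inputs with \<open>h a\<close> outside
  \<open>S\<close>.\<close>

lemma Alice_sends:
  assumes "finite S" "card S \<le> 2 ^ w" "\<And>x. depth (c x) \<le> D"
  shows "\<exists>P. depth P \<le> w + D \<and> (\<forall>a b. h a \<in> S \<longrightarrow> run P a b = run (c (h a)) a b)"
  using assms(1,2)
proof (induction w arbitrary: S)
  case 0
  then consider "S = {}" | x where "S = {x}"
    by (metis One_nat_def card_0_eq card_1_singletonE le_Suc_eq le_zero_eq power_0)
  then show ?case
  proof cases
    case 1
    then show ?thesis by (intro exI[of _ "Output 0"]) auto
  next
    case (2 x)
    then show ?thesis using assms(3) by (intro exI[of _ "c x"]) auto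
  qed
next
  case (Suc w)
  obtain S1 S2 where S: "S = S1 \<union> S2" "finite S1" "finite S2" "card S1 \<le> 2 ^ w" "card S2 \<le> 2 ^ w"
    using split_set_pow2[OF Suc.prems] .
  obtain P1 P2 where
    "depth P1 \<le> w + D" "\<And>a b. h a \<in> S1 \<Longrightarrow> run P1 a b = run (c (h a)) a b"
    "depth P2 \<le> w + D" "\<And>a b. h a \<in> S2 \<Longrightarrow> run P2 a b = run (c (h a)) a b"
    using Suc.IH[OF S(2,4)] Suc.IH[OF S(3,5)] by blast
  then show ?case
    by (intro exI[of _ "Alice (\<lambda>a. h a \<in> S1) P1 P2"]) (auto simp: S(1))
qed

lemma Bob_sends:
  assumes "finite S" "card S \<le> 2 ^ w" "\<And>x. depth (c x) \<le> D"
  shows "\<exists>P. depth P \<le> w + D \<and> (\<forall>a b. h b \<in> S \<longrightarrow> run P a b = run (c (h b)) a b)"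
  using assms(1,2)
proof (induction w arbitrary: S)
  case 0
  then consider "S = {}" | x where "S = {x}"
    by (metis One_nat_def card_0_eq card_1_singletonE le_Suc_eq le_zero_eq power_0)
  then show ?case
  proof cases
    case 1
    then show ?thesis by (intro exI[of _ "Output 0"]) auto
  next
    case (2 x)
    then show ?thesis using assms(3) by (intro exI[of _ "c x"]) auto
  qed
next
  case (Suc w)
  obtain S1 S2 where S: "S = S1 \<union> S2" "finite S1" "finite S2" "card S1 \<le> 2 ^ w" "card S2 \<le> 2 ^ w"
    using split_set_pow2[OF Suc.prems] .
  obtain P1 P2 where
    "depth P1 \<le> w + D" "\<And>a b. h b \<in> S1 \<Longrightarrow> run P1 a b = run (c (h b)) a b"
    "depth P2 \<le> w + D" "\<And>a b. h b \<in> S2 \<Longrightarrow> run P2 a b = run (c (h b)) a b"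
    using Suc.IH[OF S(2,4)] Suc.IH[OF S(3,5)] by blast
  then show ?case
    by (intro exI[of _ "Bob (\<lambda>b. h b \<in> S1) P1 P2"]) (auto simp: S(1))
qed

definition words :: "nat \<Rightarrow> nat \<Rightarrow> nat list set" where
  "words w n = {xs. set xs \<subseteq> {..<2 ^ w} \<and> length xs = n}"

lemma finite_words: "finite (words w n)"
  and card_words: "card (words w n) = 2 ^ (w * n)"
  by (simp_all add: words_def finite_lists_length_eq card_lists_length_eq power_mult)

text \<open>The tree is built from the last round backwards, since each round needs its continuation
  for every possible message. Membership in \<open>words\<close> is a premise on the individual
  inputs because the type of inputs also contains measures for which no message bound holds.\<close>

lemma three_round_protocol:
  fixes f :: "'a \<Rightarrow> nat list" and g :: "nat list \<Rightarrow> 'b \<Rightarrow> nat list"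
    and h :: "nat list \<Rightarrow> nat list \<Rightarrow> 'a \<Rightarrow> nat list"
    and out :: "nat list \<Rightarrow> nat list \<Rightarrow> nat list \<Rightarrow> real"
  shows "\<exists>P. depth P \<le> w * k + (w * l + w * m) \<and>
    (\<forall>a b. f a \<in> words w k \<and> g (f a) b \<in> words w l \<and> h (f a) (g (f a) b) a \<in> words w m \<longrightarrow>
       run P a b = out (f a) (g (f a) b) (h (f a) (g (f a) b) a))"
proof -
  have "\<exists>P::('a, 'b) protocol. depth P \<le> w * m + 0 \<and>
      (\<forall>a b. h x y a \<in> words w m \<longrightarrow> run P a b = run (Output (out x y (h x y a))) a b)" for x y
    by (rule Alice_sends[where c = "\<lambda>z. Output (out x y z)"]) (auto simp: finite_words card_words)
  then obtain C :: "nat list \<Rightarrow> nat list \<Rightarrow> ('a, 'b) protocol" where C: "\<And>x y. depth (C x y) \<le> w * m"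
    "\<And>x y a b. h x y a \<in> words w m \<Longrightarrow> run (C x y) a b = out x y (h x y a)"
    by simp metis
  have "\<exists>P. depth P \<le> w * l + w * m \<and>
      (\<forall>a b. g x b \<in> words w l \<longrightarrow> run P a b = run (C x (g x b)) a b)" for x
    by (rule Bob_sends) (auto simp: finite_words card_words C)
  then obtain B where B: "\<And>x. depth (B x) \<le> w * l + w * m"
    "\<And>x a b. g x b \<in> words w l \<Longrightarrow> run (B x) a b = run (C x (g x b)) a b"
    by metis
  have "\<exists>P. depth P \<le> w * k + (w * l + w * m) \<and>
      (\<forall>a b. f a \<in> words w k \<longrightarrow> run P a b = run (B (f a)) a b)"
    by (rule Alice_sends) (auto simp: finite_words card_words B)
  with B C show ?thesis by metis
qed

section \<open>Estimating a sum by sampling\<close>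

lemma finite_set_replicate_pmf:
  assumes "finite (set_pmf p)" shows "finite (set_pmf (replicate_pmf n p))"
  unfolding set_replicate_pmf lists_eq_set using finite_lists_length_eq[OF assms, of n]
  by (rule rev_finite_subset) auto

text \<open>Conditioning on the first draw. Finite support makes every integral here a finite
  sum.\<close>

lemma expectation_replicate_pmf_Suc:
  fixes g :: "'a list \<Rightarrow> real"
  assumes "finite (set_pmf p)"
  shows "measure_pmf.expectation (replicate_pmf (Suc n) p) g =
    measure_pmf.expectation p (\<lambda>x. measure_pmf.expectation (replicate_pmf n p) (\<lambda>xs. g (x # xs)))"
proof -
  have eq: "replicate_pmf (Suc n) p = p \<bind> (\<lambda>x. map_pmf ((#) x) (replicate_pmf n p))"
    by (simp add: map_pmf_def)
  show ?thesis
    unfolding eq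
    by (subst pmf_expectation_bind[of "set_pmf p"])
       (use assms in \<open>auto simp: finite_set_replicate_pmf integral_measure_pmf[of "set_pmf p"]\<close>)
qed

text \<open>Expanding the square after splitting off one draw leaves a cross term that vanishes
  because the remaining sum has mean zero. The second claim thus relies on the first, and one
  induction proves both.\<close>

lemma second_moment_sum_list_replicate_pmf:
  fixes h :: "'a \<Rightarrow> real"
  assumes fin: "finite (set_pmf p)" and centered: "measure_pmf.expectation p h = 0"
  shows "measure_pmf.expectation (replicate_pmf n p) (\<lambda>xs. sum_list (map h xs)) = 0"
    and "measure_pmf.expectation (replicate_pmf n p) (\<lambda>xs. (sum_list (map h xs))\<^sup>2) =
      n * measure_pmf.expectation p (\<lambda>x. (h x)\<^sup>2)"
proof (induction n)
  case 0
  { case 1 show ?case by simp }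
  { case 2 show ?case by simp }
next
  case (Suc n)
  note [simp] = integrable_measure_pmf_finite[OF fin]
    integrable_measure_pmf_finite[OF finite_set_replicate_pmf[OF fin]]
  { case 1 show ?case
      by (simp add: expectation_replicate_pmf_Suc fin Suc centered del: replicate_pmf.simps) }
  { case 2 show ?case
      by (simp add: expectation_replicate_pmf_Suc fin Suc centered power2_sum algebra_simps
            del: replicate_pmf.simps) }
qed

text \<open>Chebyshev's inequality for \<open>m\<close> uniform draws with replacement: the rescaled
  sample sum is unbiased, and a single draw of \<open>r\<close> has variance at most
  \<open>B\<^sup>2\<close>.\<close>

lemma sampled_sum_deviation:
  fixes r :: "nat \<Rightarrow> real"
  assumes N: "N > 0" and m: "m > 0" and \<delta>: "\<delta> > 0" and r: "\<And>j. j < N \<Longrightarrow> \<bar>r j\<bar> \<le> B"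
  shows "measure_pmf.prob (replicate_pmf m (pmf_of_set {..<N}))
      {xs. \<bar>N / m * sum_list (map r xs) - (\<Sum>j<N. r j)\<bar> \<le> \<delta>} \<ge> 1 - (real N)\<^sup>2 * B\<^sup>2 / (m * \<delta>\<^sup>2)"
proof -
  define p where "p = pmf_of_set {..<N}"
  define \<mu> where "\<mu> = (\<Sum>j<N. r j) / N"
  define h where "h = (\<lambda>j. r j - \<mu>)"
  let ?R = "replicate_pmf m p"
  have ne: "{..<N} \<noteq> {}" using N by auto
  have set_p: "set_pmf p = {..<N}" using ne by (simp add: p_def)
  have fin: "finite (set_pmf p)" using set_p by simp
  have finR: "finite (set_pmf ?R)" by (rule finite_set_replicate_pmf[OF fin])
  have E: "measure_pmf.expectation p f = (\<Sum>j<N. f j) / N" for f :: "nat \<Rightarrow> real"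
    using ne by (simp add: p_def integral_pmf_of_set)
  have Eh: "measure_pmf.expectation p h = 0"
    using N by (simp add: E h_def \<mu>_def sum_subtractf)
  have "measure_pmf.expectation p (\<lambda>x. (h x)\<^sup>2) = (\<Sum>j<N. (r j)\<^sup>2) / N - \<mu>\<^sup>2"
  proof -
    have "(\<Sum>j<N. (h j)\<^sup>2) = (\<Sum>j<N. (r j)\<^sup>2) - 2 * \<mu> * (\<Sum>j<N. r j) + N * \<mu>\<^sup>2"
      by (simp add: h_def power2_diff sum.distrib sum_subtractf sum_distrib_left algebra_simps)
    also have "(\<Sum>j<N. r j) = N * \<mu>" using N by (simp add: \<mu>_def)
    finally show ?thesis using N by (simp add: E field_simps power2_eq_square)
  qed
  also have "\<dots> \<le> (\<Sum>j<N. (r j)\<^sup>2) / N" by simp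
  also have "\<dots> \<le> (\<Sum>j<N. B\<^sup>2) / N"
    by (intro divide_right_mono sum_mono)
       (auto simp: abs_le_square_iff[symmetric] intro: order_trans[OF r abs_ge_self])
  also have "\<dots> = B\<^sup>2" using N by simp
  finally have var: "measure_pmf.expectation p (\<lambda>x. (h x)\<^sup>2) \<le> B\<^sup>2" .
  \<comment> \<open>The tolerance \<delta> on the scale of the centered sample sum:
    \<open>N / m * t\<close> equals \<delta>.\<close>
  define t where "t = m * \<delta> / N"
  have t: "t > 0" using N m \<delta> by (simp add: t_def)
  \<comment> \<open>On the support the sample has length exactly \<open>m\<close>, which is what
    turns the sum of \<open>h\<close> into the sum of \<open>r\<close> minus
    \<open>m * \<mu>\<close>.\<close>
  have sub: "- {xs. (sum_list (map h xs))\<^sup>2 \<ge> t\<^sup>2} \<inter> set_pmf ?R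
      \<subseteq> {xs. \<bar>N / m * sum_list (map r xs) - (\<Sum>j<N. r j)\<bar> \<le> \<delta>}"
  proof
    fix xs assume xs: "xs \<in> - {xs. (sum_list (map h xs))\<^sup>2 \<ge> t\<^sup>2} \<inter> set_pmf ?R"
    then have len: "length xs = m" by (simp add: set_replicate_pmf)
    have "(sum_list (map h xs))\<^sup>2 < t\<^sup>2" using xs by auto
    then have "\<bar>sum_list (map h xs)\<bar> \<le> t" using t
      by (metis abs_le_square_iff abs_of_pos less_imp_le)
    moreover have "sum_list (map h xs) = sum_list (map r xs) - m * \<mu>"
      unfolding len[symmetric] h_def by (induction xs) (auto simp: algebra_simps)
    moreover have "N / m * sum_list (map r xs) - (\<Sum>j<N. r j) = N / m * (sum_list (map r xs) - m * \<mu>)"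
      using N m by (simp add: \<mu>_def field_simps)
    ultimately have "\<bar>N / m * sum_list (map r xs) - (\<Sum>j<N. r j)\<bar> \<le> N / m * t"
      by (simp only: abs_mult abs_of_nonneg divide_nonneg_nonneg of_nat_0_le_iff mult_left_mono)
    also have "\<dots> = \<delta>" using N m by (simp add: t_def)
    finally show "xs \<in> {xs. \<bar>N / m * sum_list (map r xs) - (\<Sum>j<N. r j)\<bar> \<le> \<delta>}" by simp
  qed
  have "measure_pmf.prob ?R {xs. (sum_list (map h xs))\<^sup>2 \<ge> t\<^sup>2}
      \<le> measure_pmf.expectation ?R (\<lambda>xs. (sum_list (map h xs))\<^sup>2) / t\<^sup>2"
    using integral_Markov_inequality_measure[of "measure_pmf ?R" "\<lambda>xs. (sum_list (map h xs))\<^sup>2" UNIV "t\<^sup>2"] t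
    by (simp add: integrable_measure_pmf_finite[OF finR])
  also have "\<dots> \<le> m * B\<^sup>2 / t\<^sup>2"
    by (simp add: second_moment_sum_list_replicate_pmf[OF fin Eh] divide_right_mono mult_left_mono var)
  also have "\<dots> = (real N)\<^sup>2 * B\<^sup>2 / (m * \<delta>\<^sup>2)"
    using N m \<delta> by (simp add: t_def field_simps power2_eq_square)
  finally have "1 - (real N)\<^sup>2 * B\<^sup>2 / (m * \<delta>\<^sup>2) \<le> measure_pmf.prob ?R (- {xs. (sum_list (map h xs))\<^sup>2 \<ge> t\<^sup>2})"
    using measure_pmf.prob_compl[of "{xs. (sum_list (map h xs))\<^sup>2 \<ge> t\<^sup>2}" ?R]
    by (simp add: Compl_eq_Diff_UNIV)
  also have "\<dots> = measure_pmf.prob ?R (- {xs. (sum_list (map h xs))\<^sup>2 \<ge> t\<^sup>2} \<inter> set_pmf ?R)"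
    by (simp add: measure_Int_set_pmf)
  also have "\<dots> \<le> measure_pmf.prob ?R {xs. \<bar>N / m * sum_list (map r xs) - (\<Sum>j<N. r j)\<bar> \<le> \<delta>}"
    by (rule measure_pmf.finite_measure_mono[OF sub]) simp
  finally show ?thesis by (simp add: p_def)
qed

section \<open>Discretization\<close>

text \<open>For \<open>x \<le> y\<close> the sum counts the grid points in the half-open interval
  from \<open>x\<close> to \<open>y\<close>. This count is a difference of two ceilings and hence is
  within 1 of \<open>N * (y - x)\<close>.\<close>

lemma abs_diff_discretized:
  fixes x y :: real and N :: nat
  assumes N: "N > 0" and x: "x \<in> {0..1}" and y: "y \<in> {0..1}"
  shows "\<bar>\<bar>x - y\<bar> - (\<Sum>j<N. \<bar>of_bool (x \<le> j / N) - of_bool (y \<le> j / N)\<bar>) / N\<bar> \<le> 1 / N"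
  using x y
proof (induction x y rule: linorder_wlog)
  case (le x y)
  have count: "(\<Sum>j<N. of_bool (z \<le> j / N)) = N - real_of_int \<lceil>N * z\<rceil>" if z: "z \<in> {0..1}" for z :: real
  proof -
    have b: "0 \<le> \<lceil>N * z\<rceil>" "\<lceil>N * z\<rceil> \<le> N"
      using z by (auto simp: ceiling_le_iff mult_left_le intro: less_le_trans[of _ 0])
    have "z \<le> j / N \<longleftrightarrow> nat \<lceil>N * z\<rceil> \<le> j" for j :: nat
    proof -
      have "z \<le> j / N \<longleftrightarrow> N * z \<le> real_of_int (int j)" using N by (simp add: field_simps)
      then show ?thesis by (simp only: ceiling_le_iff[symmetric] nat_le_iff)
    qed
    then have "(\<Sum>j<N. of_bool (z \<le> j / N)) = (\<Sum>j<N. of_bool (nat \<lceil>N * z\<rceil> \<le> j) :: real)"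
      by simp
    also have "\<dots> = card {j\<in>{..<N}. nat \<lceil>N * z\<rceil> \<le> j}"
      by (simp add: of_bool_def sum.If_cases Int_def)
    also have "{j\<in>{..<N}. nat \<lceil>N * z\<rceil> \<le> j} = {nat \<lceil>N * z\<rceil>..<N}" by auto
    finally show ?thesis using b by (simp add: of_nat_diff nat_le_iff)
  qed
  have "(\<Sum>j<N. \<bar>of_bool (x \<le> j / N) - of_bool (y \<le> j / N)\<bar>) =
      (\<Sum>j<N. of_bool (x \<le> j / N) - of_bool (y \<le> j / N) :: real)"
    using le by (intro sum.cong) auto
  also have "\<dots> = real_of_int \<lceil>N * y\<rceil> - real_of_int \<lceil>N * x\<rceil>"
    using le unfolding sum_subtractf by (subst (1 2) count) auto
  finally have eq: "(\<Sum>j<N. \<bar>of_bool (x \<le> j / N) - of_bool (y \<le> j / N)\<bar>) =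
    real_of_int \<lceil>N * y\<rceil> - real_of_int \<lceil>N * x\<rceil>" .
  have "\<bar>N * (y - x) - (real_of_int \<lceil>N * y\<rceil> - real_of_int \<lceil>N * x\<rceil>)\<bar> \<le> 1"
    unfolding right_diff_distrib by linarith
  then have "\<bar>(N * (y - x) - (real_of_int \<lceil>N * y\<rceil> - real_of_int \<lceil>N * x\<rceil>)) / N\<bar> \<le> 1 / N"
    using N by (simp add: abs_divide divide_right_mono)
  moreover have "\<bar>x - y\<bar> = y - x" using le by simp
  ultimately show ?case unfolding eq using N by (simp add: diff_divide_distrib)
next
  case (sym x y)
  then show ?case by (simp add: abs_minus_commute)
qed


text \<open>The distribution function of \<open>p\<close> at the grid point \<open>j / N\<close>, in
  units of \<open>1 / N\<close> and rounded down. Being integers, levels can be sent exactly, and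
  the later split into quotient and remainder is exact as well.\<close>

definition level :: "nat \<Rightarrow> real measure \<Rightarrow> nat \<Rightarrow> nat" where
  "level N p j = nat \<lfloor>N * measure p {x \<in> space p. x \<le> j / N}\<rfloor>"

lemma level_bounds:
  fixes j :: nat
  assumes "prob_space p" "N > 0"
  defines "F \<equiv> measure p {x \<in> space p. x \<le> j / N}"
  shows "level N p j / N \<le> F" "F \<le> level N p j / N + 1 / N" "level N p j \<le> N"
proof -
  have F: "0 \<le> F" "F \<le> 1" using prob_space.prob_le_1[OF assms(1)] by (auto simp: F_def)
  then have "0 \<le> \<lfloor>N * F\<rfloor>" by simp
  then have "real (level N p j) = real_of_int \<lfloor>N * F\<rfloor>" by (simp add: level_def F_def)
  then have *: "level N p j \<le> N * F" "N * F \<le> level N p j + 1" by linarith+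
  then show "level N p j / N \<le> F" "F \<le> level N p j / N + 1 / N"
    using assms(2) by (auto simp: field_simps)
  have "N * F \<le> N" using F by (simp add: mult_left_le)
  with * show "level N p j \<le> N" by linarith
qed

lemma level_mono:
  assumes "p \<in> space (prob_algebra unit_borel)" "j \<le> k"
  shows "level N p j \<le> level N p k"
proof -
  have p: "prob_space p" "sets p = sets unit_borel" using assms(1) by (auto simp: space_prob_algebra)
  interpret prob_space p by fact
  have [measurable]: "(\<lambda>x. x) \<in> borel_measurable p"
    using p(2) by (auto cong: measurable_cong_sets simp: unit_borel_def intro: measurable_restrict_space1)
  have "real j / N \<le> k / N" using assms(2) by (simp add: divide_right_mono)
  then have "measure p {x \<in> space p. x \<le> j / N} \<le> measure p {x \<in> space p. x \<le> k / N}"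
    by (intro finite_measure_mono) auto
  then show ?thesis unfolding level_def by (intro nat_mono floor_mono mult_left_mono) auto
qed

text \<open>Integrate the pointwise estimate \<open>abs_diff_discretized\<close>. For truth values
  the absolute difference is \<open>u + v - 2 * u * v\<close>, and the product term integrates to
  \<open>F j * G j\<close> because the measure is a product.\<close>

lemma expectation_Abs_discretized:
  assumes p: "p \<in> space (prob_algebra unit_borel)" and q: "q \<in> space (prob_algebra unit_borel)"
    and N: "N > 0"
  defines "F \<equiv> \<lambda>j. measure p {x \<in> space p. x \<le> real j / real N}"
    and "G \<equiv> \<lambda>j. measure q {x \<in> space q. x \<le> real j / real N}"
  shows "\<bar>(\<integral>(x, y). Abs x y \<partial>(p \<Otimes>\<^sub>M q)) - (\<Sum>j<N. F j + G j - 2 * F j * G j) / N\<bar> \<le> 1 / N"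
proof -
  have p': "prob_space p" "sets p = sets unit_borel" "space p = {0..1}"
    using p by (auto simp: space_prob_algebra unit_borel_def space_restrict_space dest: sets_eq_imp_space_eq)
  have q': "prob_space q" "sets q = sets unit_borel" "space q = {0..1}"
    using q by (auto simp: space_prob_algebra unit_borel_def space_restrict_space dest: sets_eq_imp_space_eq)
  interpret MP: prob_space p by fact
  interpret MQ: prob_space q by fact
  interpret pair_prob_space p q ..
  have [measurable]: "(\<lambda>x. x) \<in> borel_measurable p" "(\<lambda>x. x) \<in> borel_measurable q"
    using p'(2) q'(2)
    by (auto cong: measurable_cong_sets simp: unit_borel_def intro: measurable_restrict_space1)
  define I where "I = (\<lambda>j. {x \<in> space p. x \<le> real j / real N})"
  define J where "J = (\<lambda>j. {x \<in> space q. x \<le> real j / real N})"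
  have [measurable]: "I j \<in> sets p" "J j \<in> sets q" for j by (auto simp: I_def J_def)
  define g where "g = (\<lambda>j z. indicator (I j \<times> space q) z + indicator (space p \<times> J j) z
    - 2 * indicator (I j \<times> J j) z :: real)"
  define f where "f = (\<lambda>z. case z of (x, y) \<Rightarrow> Abs x y)"
  have int_ind: "integrable (p \<Otimes>\<^sub>M q) (indicator A :: _ \<Rightarrow> real)" if "A \<in> sets (p \<Otimes>\<^sub>M q)" for A
    using that by (simp add: P.emeasure_finite less_top[symmetric])
  have times: "measure (p \<Otimes>\<^sub>M q) (A \<times> B) = measure p A * measure q B" if "A \<in> sets p" "B \<in> sets q" for A B
    using that by (simp add: measure_def MQ.emeasure_pair_measure_Times enn2real_mult)
  have gint: "integrable (p \<Otimes>\<^sub>M q) (g j)" for j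
    unfolding g_def by (intro Bochner_Integration.integrable_diff Bochner_Integration.integrable_add
        integrable_mult_right int_ind) auto
  have g: "(\<integral>z. g j z \<partial>(p \<Otimes>\<^sub>M q)) = F j + G j - 2 * F j * G j" for j
  proof -
    have [simp]: "integrable (p \<Otimes>\<^sub>M q) (indicator (I j \<times> space q) :: _ \<Rightarrow> real)"
      "integrable (p \<Otimes>\<^sub>M q) (indicator (space p \<times> J j) :: _ \<Rightarrow> real)"
      "integrable (p \<Otimes>\<^sub>M q) (indicator (I j \<times> J j) :: _ \<Rightarrow> real)"
      by (auto intro!: int_ind)
    have "(\<integral>z. g j z \<partial>(p \<Otimes>\<^sub>M q)) = measure (p \<Otimes>\<^sub>M q) (I j \<times> space q)
        + measure (p \<Otimes>\<^sub>M q) (space p \<times> J j) - 2 * measure (p \<Otimes>\<^sub>M q) (I j \<times> J j)"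
      unfolding g_def by simp
    then show ?thesis by (simp add: times MP.prob_space MQ.prob_space F_def G_def I_def J_def)
  qed
  have [measurable]: "f \<in> borel_measurable (p \<Otimes>\<^sub>M q)"
    unfolding f_def Abs_def by measurable
  have fint: "integrable (p \<Otimes>\<^sub>M q) f"
    by (rule P.integrable_const_bound[where B = 1])
       (auto simp: f_def Abs_def space_pair_measure p' q' intro!: AE_I2)
  have close: "\<bar>f z - (\<Sum>j<N. g j z) / N\<bar> \<le> 1 / N" if z_in: "z \<in> space (p \<Otimes>\<^sub>M q)" for z
  proof -
    obtain x y where z: "z = (x, y)" "x \<in> {0..1}" "y \<in> {0..1}"
      using z_in by (auto simp: space_pair_measure p' q')
    have "g j z = \<bar>of_bool (x \<le> j / N) - of_bool (y \<le> j / N)\<bar>" for j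
      using z by (auto simp: g_def I_def J_def p' q' indicator_def)
    then show ?thesis using abs_diff_discretized[OF N z(2,3)] by (simp add: f_def Abs_def z(1))
  qed
  have eq: "(\<integral>z. f z - (\<Sum>j<N. g j z) / N \<partial>(p \<Otimes>\<^sub>M q)) =
      (\<integral>z. f z \<partial>(p \<Otimes>\<^sub>M q)) - (\<Sum>j<N. F j + G j - 2 * F j * G j) / N"
    by (simp add: fint gint g Bochner_Integration.integral_sum)
  have int: "integrable (p \<Otimes>\<^sub>M q) (\<lambda>z. f z - (\<Sum>j<N. g j z) / N)"
    by (simp add: fint gint)
  have "(\<integral>z. f z - (\<Sum>j<N. g j z) / N \<partial>(p \<Otimes>\<^sub>M q)) \<le> 1 / N"
    by (rule P.integral_le_const[OF int]) (auto dest!: close intro!: AE_I2)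
  moreover have "(\<integral>z. f z - (\<Sum>j<N. g j z) / N \<partial>(p \<Otimes>\<^sub>M q)) \<ge> - (1 / N)"
    by (rule P.integral_ge_const[OF int]) (auto dest!: close intro!: AE_I2)
  ultimately have "\<bar>(\<integral>z. f z \<partial>(p \<Otimes>\<^sub>M q)) - (\<Sum>j<N. F j + G j - 2 * F j * G j) / N\<bar> \<le> 1 / N"
    unfolding eq by linarith
  then show ?thesis by (simp only: f_def)
qed

text \<open>The expression \<open>u + v - 2 * u * v\<close> is affine in each variable with slope in
  [-1,1] on the unit square, so rounding \<open>F\<close> and \<open>G\<close> costs
  \<open>1 / N\<close> each, on top of the \<open>1 / N\<close> for the grid.\<close>

lemma expectation_Abs_levels:
  assumes p: "p \<in> space (prob_algebra unit_borel)" and q: "q \<in> space (prob_algebra unit_borel)"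
    and N: "N > 0"
  defines "a \<equiv> level N p" and "b \<equiv> level N q"
  shows "\<bar>(\<integral>(x, y). Abs x y \<partial>(p \<Otimes>\<^sub>M q)) -
    (((\<Sum>j<N. a j) + (\<Sum>j<N. b j)) / N ^ 2 - 2 / N ^ 3 * (\<Sum>j<N. a j * b j))\<bar> \<le> 3 / N"
proof -
  have pq: "prob_space p" "prob_space q" using p q by (auto simp: space_prob_algebra)
  define F where "F = (\<lambda>j. measure p {x \<in> space p. x \<le> real j / real N})"
  define G where "G = (\<lambda>j. measure q {x \<in> space q. x \<le> real j / real N})"
  define V where "V = (\<lambda>j. a j / N + b j / N - 2 * (a j / N) * (b j / N))"
  have close: "\<bar>(F j + G j - 2 * F j * G j) - V j\<bar> \<le> 2 / N" for j
  proof -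
    let ?u = "a j / N" and ?v = "b j / N"
    have uv: "?u \<le> F j" "F j \<le> ?u + 1 / N" "?v \<le> G j" "G j \<le> ?v + 1 / N"
      using level_bounds[OF pq(1) N] level_bounds[OF pq(2) N] by (auto simp: a_def b_def F_def G_def)
    have "?u \<le> 1" using level_bounds(3)[OF pq(1) N] N by (simp add: a_def)
    moreover have "0 \<le> ?u" by simp
    ultimately have u: "\<bar>1 - 2 * ?u\<bar> \<le> 1" by linarith
    have "0 \<le> G j" "G j \<le> 1" using prob_space.prob_le_1[OF pq(2)] by (auto simp: G_def)
    then have G: "\<bar>1 - 2 * G j\<bar> \<le> 1" by linarith
    \<comment> \<open>The two values are replaced one after the other: first \<open>F j\<close> with
      \<open>G j\<close> kept, then \<open>G j\<close> with \<open>?u\<close> already in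
      place.\<close>
    have "\<bar>(F j + G j - 2 * F j * G j) - V j\<bar> = \<bar>(F j - ?u) * (1 - 2 * G j) + (G j - ?v) * (1 - 2 * ?u)\<bar>"
      unfolding V_def by (rule arg_cong[where f = abs], algebra)
    also have "\<dots> \<le> \<bar>F j - ?u\<bar> * \<bar>1 - 2 * G j\<bar> + \<bar>G j - ?v\<bar> * \<bar>1 - 2 * ?u\<bar>"
      by (metis abs_mult abs_triangle_ineq)
    also have "\<dots> \<le> 1 / N * 1 + 1 / N * 1"
      using uv u G by (intro add_mono mult_mono) auto
    finally show ?thesis by simp
  qed
  have "\<bar>(\<Sum>j<N. F j + G j - 2 * F j * G j) / N - (\<Sum>j<N. V j) / N\<bar>
      = \<bar>\<Sum>j<N. (F j + G j - 2 * F j * G j) - V j\<bar> / N"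
    by (simp add: sum_subtractf diff_divide_distrib[symmetric])
  also have "\<dots> \<le> (\<Sum>j<N. 2 / N) / N"
    by (intro divide_right_mono order_trans[OF sum_abs] sum_mono close) simp
  also have "\<dots> = 2 / N" using N by simp
  finally have 1: "\<bar>(\<Sum>j<N. F j + G j - 2 * F j * G j) / N - (\<Sum>j<N. V j) / N\<bar> \<le> 2 / N" .
  have 2: "(\<Sum>j<N. V j) / N =
      ((\<Sum>j<N. a j) + (\<Sum>j<N. b j)) / N ^ 2 - 2 / N ^ 3 * (\<Sum>j<N. a j * b j)"
    using N by (simp add: V_def sum.distrib sum_subtractf sum_divide_distrib sum_distrib_left
        add_divide_distrib diff_divide_distrib power2_eq_square power3_eq_cube mult_ac)
  have "\<bar>(\<integral>(x, y). Abs x y \<partial>(p \<Otimes>\<^sub>M q)) - (\<Sum>j<N. F j + G j - 2 * F j * G j) / N\<bar> \<le> 1 / N"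
    using expectation_Abs_discretized[OF p q N] by (simp add: F_def G_def)
  with 1 have "\<bar>(\<integral>(x, y). Abs x y \<partial>(p \<Otimes>\<^sub>M q)) - (\<Sum>j<N. V j) / N\<bar> \<le> 1 / N + 2 / N"
    by linarith
  then show ?thesis unfolding 2 by simp
qed

section \<open>The protocol\<close>

text \<open>For monotone \<open>a\<close> the cardinality is the first index at which
  \<open>a\<close> reaches the threshold \<open>i * L\<close>, or \<open>N\<close> if this never
  happens below \<open>N\<close>.\<close>

definition breakpoints :: "nat \<Rightarrow> nat \<Rightarrow> (nat \<Rightarrow> nat) \<Rightarrow> nat list" where
  "breakpoints N L a = map (\<lambda>i. card {k. k < N \<and> a k < i * L}) [1..<Suc (N div L)]"

definition step_function :: "nat \<Rightarrow> nat list \<Rightarrow> nat \<Rightarrow> nat" where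
  "step_function L c j = L * length (filter (\<lambda>t. t \<le> j) c)"

text \<open>The \<open>i\<close>-th breakpoint is at most \<open>j\<close> iff \<open>a j\<close>
  has reached \<open>i * L\<close>. Hence the breakpoints up to \<open>j\<close> number
  \<open>a j div L\<close>, and decoding yields \<open>a j\<close> rounded down to a multiple of
  \<open>L\<close>.\<close>

lemma step_function_breakpoints:
  assumes mono: "\<And>j k. j \<le> k \<Longrightarrow> a j \<le> a k" and le: "a j \<le> N" and j: "j < N" and L: "L > 0"
  shows "step_function L (breakpoints N L a) j = L * (a j div L)"
proof -
  have iff: "card {k. k < N \<and> a k < i * L} \<le> j \<longleftrightarrow> i \<le> a j div L" for i
  proof
    assume "card {k. k < N \<and> a k < i * L} \<le> j"
    \<comment> \<open>The initial segment up to \<open>j\<close> has \<open>j + 1\<close> elements,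
      one too many to fit.\<close>
    then have "\<not> {..j} \<subseteq> {k. k < N \<and> a k < i * L}"
      using card_mono[of "{k. k < N \<and> a k < i * L}" "{..j}"] by auto
    then obtain k where "k \<le> j" "\<not> a k < i * L" using j by auto
    then have "i * L \<le> a j" using mono[of k j] by linarith
    then show "i \<le> a j div L" using L by (simp add: less_eq_div_iff_mult_less_eq)
  next
    assume "i \<le> a j div L"
    then have "i * L \<le> a j" using L by (simp add: less_eq_div_iff_mult_less_eq)
    then have "k < j" if "a k < i * L" for k using mono[of j k] that by linarith
    then have "{k. k < N \<and> a k < i * L} \<subseteq> {..<j}" by auto
    then show "card {k. k < N \<and> a k < i * L} \<le> j"
      by (metis card_lessThan card_mono finite_lessThan)
  qed
  have "a j div L \<le> N div L" using le by (simp add: div_le_mono)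
  then have "{i. i \<le> a j div L} \<inter> set [1..<Suc (N div L)] = {1..a j div L}" by auto
  then show ?thesis
    by (simp add: step_function_def breakpoints_def filter_map comp_def iff distinct_length_filter
          del: upt_Suc)
qed


lemma length_breakpoints: "length (breakpoints N L a) = N div L"
  by (simp add: breakpoints_def del: upt_Suc)

lemma set_breakpoints: "set (breakpoints N L a) \<subseteq> {..N}"
proof -
  have "card {k. k < N \<and> a k < i * L} \<le> N" for i
    using card_mono[of "{..<N}" "{k. k < N \<and> a k < i * L}"] by auto
  then show ?thesis by (auto simp: breakpoints_def)
qed

text \<open>Given the quotients of both players, Bob can compute the first sum and Alice the second.
  Only the sum of products of remainders involves private data of both, and its terms are
  small.\<close>

lemma sum_product_split:
  fixes a b :: "nat \<Rightarrow> nat"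
  shows "(\<Sum>j\<in>S. L * (a j div L) * b j) + (\<Sum>j\<in>S. a j mod L * (L * (b j div L)))
    + (\<Sum>j\<in>S. (a j mod L) * (b j mod L)) = (\<Sum>j\<in>S. a j * b j)"
proof -
  have "L * (a j div L) * b j + a j mod L * (L * (b j div L)) + (a j mod L) * (b j mod L) = a j * b j" for j
    by (metis (no_types, lifting) add.assoc distrib_left distrib_right mult_div_mod_eq)
  then show ?thesis by (simp add: sum.distrib[symmetric])
qed

text \<open>For a fixed sample \<open>s\<close> everything is exact except that the sum of remainder
  products is replaced by its sample estimate. Alice sends her breakpoints; Bob answers with his
  breakpoints, his remainders on \<open>s\<close> and two sums; Alice closes with her remainders and
  two sums.\<close>

lemma levels_protocol:
  fixes N L m w :: nat and s :: "nat list"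
  assumes N: "N > 0" and L: "L > 0" and w: "N ^ 3 < 2 ^ w"
  defines "U \<equiv> space (prob_algebra unit_borel)"
  shows "\<exists>P. depth P \<le> w * (2 * (N div L) + 2 * m + 4) \<and>
    (\<forall>p\<in>U. \<forall>q\<in>U. length s = m \<longrightarrow> run P p q =
       ((\<Sum>j<N. level N p j) + (\<Sum>j<N. level N q j)) / N ^ 2
       - 2 / N ^ 3 * ((\<Sum>j<N. level N p j * level N q j)
          + (N / m * (\<Sum>j\<leftarrow>s. real ((level N p j mod L) * (level N q j mod L)))
             - (\<Sum>j<N. real ((level N p j mod L) * (level N q j mod L))))))"
proof -
  define K where "K = N div L"
  define f where "f = (\<lambda>p. breakpoints N L (level N p))"
  define g where "g = (\<lambda>c q. f q @ map (\<lambda>j. level N q j mod L) s @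
    [\<Sum>j<N. level N q j, \<Sum>j<N. step_function L c j * level N q j])"
  \<comment> \<open>Bob's breakpoints are the first \<open>K\<close> entries of his message
    \<open>d\<close>. After them come \<open>m\<close> remainders, at offset \<open>K + m\<close>
    his level sum, and then his cross sum.\<close>
  define h where "h = (\<lambda>(c::nat list) d p. map (\<lambda>j. level N p j mod L) s @
    [\<Sum>j<N. level N p j, \<Sum>j<N. level N p j mod L * step_function L (take K d) j])"
  define out where "out = (\<lambda>(c::nat list) d e. (real (e ! m) + real (d ! (K + m))) / N ^ 2
    - 2 / N ^ 3 * (real (d ! (K + m + 1)) + real (e ! (m + 1))
       + N / m * (\<Sum>x\<leftarrow>map2 (*) (take m e) (take m (drop K d)). real x)))"
  obtain P where P: "depth P \<le> w * K + (w * (K + m + 2) + w * (m + 2))"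
    "\<And>p q. \<lbrakk>f p \<in> words w K; g (f p) q \<in> words w (K + m + 2); h (f p) (g (f p) q) p \<in> words w (m + 2)\<rbrakk>
      \<Longrightarrow> run P p q = out (f p) (g (f p) q) (h (f p) (g (f p) q) p)"
    using three_round_protocol[of w K "K + m + 2" "m + 2" f g h out] by blast
  have lenf: "length (f p) = K" for p by (simp add: f_def K_def length_breakpoints)
  have "run P p q =
       ((\<Sum>j<N. level N p j) + (\<Sum>j<N. level N q j)) / N ^ 2
       - 2 / N ^ 3 * ((\<Sum>j<N. level N p j * level N q j)
          + (N / m * (\<Sum>j\<leftarrow>s. real ((level N p j mod L) * (level N q j mod L)))
             - (\<Sum>j<N. real ((level N p j mod L) * (level N q j mod L)))))"
    if pq: "p \<in> U" "q \<in> U" and s: "length s = m" for p q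
  proof -
    define a b where "a = level N p" and "b = level N q"
    have prob: "prob_space p" "prob_space q" using pq by (auto simp: U_def space_prob_algebra)
    have le: "a j \<le> N" "b j \<le> N" for j
      using level_bounds(3)[OF prob(1) N] level_bounds(3)[OF prob(2) N] by (auto simp: a_def b_def)
    have mono: "a j \<le> a k" "b j \<le> b k" if "j \<le> k" for j k
      using level_mono pq that by (auto simp: a_def b_def U_def)
    have step: "step_function L (f p) j = L * (a j div L)" "step_function L (f q) j = L * (b j div L)"
      if "j < N" for j
      unfolding f_def using step_function_breakpoints[OF mono(1) le(1) that L]
        step_function_breakpoints[OF mono(2) le(2) that L] by (auto simp: a_def b_def)
    have N3: "x < 2 ^ w" if "x \<le> N" for x
      using that w self_le_power[of N 3] N by linarith
    \<comment> \<open>The largest numbers sent are sums of \<open>N\<close> products of levels,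
      whence the cube in the hypothesis on \<open>w\<close>.\<close>
    have sum_lt: "(\<Sum>j<N. u j) < 2 ^ w" if "\<And>j. j < N \<Longrightarrow> u j \<le> N * N" for u
    proof -
      have "(\<Sum>j<N. u j) \<le> N * (N * N)" using sum_bounded_above[of "{..<N}" u "N * N"] that by simp
      with w show ?thesis by (simp add: power3_eq_cube)
    qed
    have res: "a j mod L < 2 ^ w" "b j mod L < 2 ^ w" for j
      by (meson N3 le mod_less_eq_dividend order_trans)+
    have lin: "a j \<le> N * N" "b j \<le> N * N" for j using le N by (meson le_square order_trans)+
    have prodb: "L * (a j div L) * b j \<le> N * N" "a j mod L * (L * (b j div L)) \<le> N * N" for j
      by (intro mult_le_mono order_trans[OF _ le(1)[of j]] order_trans[OF _ le(2)[of j]]; simp)+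
    have takeg: "take K (g c q) = f q" for c by (simp add: g_def lenf)
    have fw: "f x \<in> words w K" if "x \<in> U" for x
      using set_breakpoints[of N L] N3 by (force simp: words_def lenf f_def K_def length_breakpoints)
    have g_eq: "g (f p) q = f q @ map (\<lambda>j. b j mod L) s @
        [\<Sum>j<N. b j, \<Sum>j<N. L * (a j div L) * b j]"
      using step by (simp add: g_def b_def)
    have h_eq: "h (f p) (g (f p) q) p = map (\<lambda>j. a j mod L) s @
        [\<Sum>j<N. a j, \<Sum>j<N. a j mod L * (L * (b j div L))]"
      using step by (simp add: h_def takeg a_def)
    have "set (f q) \<subseteq> {..<2 ^ w}" using fw[OF pq(2)] by (simp add: words_def)
    then have gw: "g (f p) q \<in> words w (K + m + 2)"
      unfolding g_eq words_def using res lin prodb s by (auto simp: lenf intro!: sum_lt)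
    have hw: "h (f p) (g (f p) q) p \<in> words w (m + 2)"
      unfolding h_eq words_def using res lin prodb s by (auto intro!: sum_lt)
    have "run P p q = out (f p) (g (f p) q) (h (f p) (g (f p) q) p)"
      by (rule P(2)[OF fw[OF pq(1)] gw hw])
    also have "\<dots> = (real (\<Sum>j<N. a j) + real (\<Sum>j<N. b j)) / N ^ 2
        - 2 / N ^ 3 * (real (\<Sum>j<N. L * (a j div L) * b j) + real (\<Sum>j<N. a j mod L * (L * (b j div L)))
           + N / m * (\<Sum>j\<leftarrow>s. real ((a j mod L) * (b j mod L))))"
      unfolding h_eq unfolding g_eq out_def using s
      by (simp add: lenf nth_append map2_map_map comp_def del: of_nat_mult of_nat_sum)
    also have "real (\<Sum>j<N. L * (a j div L) * b j) + real (\<Sum>j<N. a j mod L * (L * (b j div L))) =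
        real (\<Sum>j<N. a j * b j) - (\<Sum>j<N. real ((a j mod L) * (b j mod L)))"
      unfolding sum_product_split[of L a b "{..<N}", symmetric] by simp
    finally show ?thesis by (simp add: a_def b_def algebra_simps)
  qed
  moreover have "depth P \<le> w * (2 * (N div L) + 2 * m + 4)"
    using P(1) by (simp add: K_def algebra_simps)
  ultimately show ?thesis by blast
qed

text \<open>The shared randomness is the sample. Half of the error \<epsilon> goes to
  discretization, as \<open>3 / N \<le> \<epsilon> / 2\<close>, and half to sampling. Remainder
  products are at most \<open>L ^ 2\<close>, and \<open>m\<epsilon>\<close> bounds the failure
  probability by 1/3.\<close>

lemma R_shared_Abs_le:
  fixes N L m w :: nat and \<epsilon> :: real
  assumes N: "N > 0" and L: "L > 0" and m: "m > 0" and w: "N ^ 3 < 2 ^ w" and \<epsilon>: "\<epsilon> > 0"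
    and N\<epsilon>: "6 / N \<le> \<epsilon>" and m\<epsilon>: "48 * (L / N) ^ 4 \<le> m * \<epsilon>\<^sup>2"
  shows "R_shared \<epsilon> unit_borel unit_borel Abs \<le> enat (w * (2 * (N div L) + 2 * m + 4))"
proof -
  define U where "U = space (prob_algebra unit_borel)"
  define r where "r = (\<lambda>p q j. real ((level N p j mod L) * (level N q j mod L)))"
  define \<Omega> where "\<Omega> = replicate_pmf m (pmf_of_set {..<N})"
  define val where "val = (\<lambda>s p q. ((\<Sum>j<N. level N p j) + (\<Sum>j<N. level N q j)) / N ^ 2
     - 2 / N ^ 3 * ((\<Sum>j<N. level N p j * level N q j)
        + (N / m * (\<Sum>j\<leftarrow>s. r p q j) - (\<Sum>j<N. r p q j))))"
  \<comment> \<open>The depth bound covers lists \<open>s\<close> of every length, as the worst-case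
    cost later ranges over all of \<open>range P\<close>.\<close>
  have "\<forall>s. \<exists>P. depth P \<le> w * (2 * (N div L) + 2 * m + 4) \<and>
      (\<forall>p\<in>U. \<forall>q\<in>U. length s = m \<longrightarrow> run P p q = val s p q)"
    unfolding U_def val_def r_def by (intro allI levels_protocol[OF N L w])
  from choice[OF this] obtain P where P: "\<And>s. depth (P s) \<le> w * (2 * (N div L) + 2 * m + 4)"
    "\<And>s p q. \<lbrakk>p \<in> U; q \<in> U; length s = m\<rbrakk> \<Longrightarrow> run (P s) p q = val s p q"
    by blast
  \<comment> \<open>The worst-case cost ranges over the whole space of \<open>M\<close>, and the space of a pmf is \<open>UNIV\<close>, hence
    the push-forward to \<open>range P\<close>.\<close>
  define M where "M = distr (measure_pmf \<Omega>) (count_space (range P)) P"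
  have meas: "P \<in> measurable (measure_pmf \<Omega>) (count_space (range P))" by simp
  have "estimates \<epsilon> unit_borel unit_borel Abs M"
    unfolding estimates_def Let_def
  proof (intro conjI ballI)
    show "prob_space M" unfolding M_def by (rule measure_pmf.prob_space_distr[OF meas])
    fix p q assume "p \<in> space (prob_algebra unit_borel)" "q \<in> space (prob_algebra unit_borel)"
    then have pq: "p \<in> U" "q \<in> U" by (simp_all add: U_def)
    let ?I = "\<integral>(x, y). Abs x y \<partial>(p \<Otimes>\<^sub>M q)"
    let ?good = "{P \<in> space M. \<bar>run P p q - ?I\<bar> \<le> \<epsilon>}"
    show good: "?good \<in> sets M" by (auto simp: M_def)
    \<comment> \<open>The output scales the sampling error by \<open>2 / N ^ 3\<close>, which turns
      \<delta> into \<open>\<epsilon> / 2\<close>.\<close>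
    define \<delta> where "\<delta> = \<epsilon> * N ^ 3 / 4"
    have \<delta>: "\<delta> > 0" using N \<epsilon> by (simp add: \<delta>_def)
    define D where "D = {s. \<bar>N / m * sum_list (map (r p q) s) - (\<Sum>j<N. r p q j)\<bar> \<le> \<delta>}"
    have r: "\<bar>r p q j\<bar> \<le> real L ^ 2" for j
    proof -
      have "(level N p j mod L) * (level N q j mod L) \<le> L * L"
        using L by (intro mult_le_mono) (auto intro: less_imp_le)
      then show ?thesis unfolding r_def power2_eq_square by (simp flip: of_nat_mult)
    qed
    have "1 - (real N)\<^sup>2 * (real L ^ 2)\<^sup>2 / (m * \<delta>\<^sup>2) \<le> measure_pmf.prob \<Omega> D"
      unfolding \<Omega>_def D_def by (rule sampled_sum_deviation[OF N m \<delta>, where r = "r p q"]) (rule r)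
    moreover have "(real N)\<^sup>2 * (real L ^ 2)\<^sup>2 / (m * \<delta>\<^sup>2) \<le> 1 / 3"
    proof -
      have "48 * real L ^ 4 \<le> m * \<epsilon>\<^sup>2 * N ^ 4" using m\<epsilon> N by (simp add: power_divide field_simps)
      then have "48 * real L ^ 4 * N\<^sup>2 \<le> m * \<epsilon>\<^sup>2 * N ^ 4 * N\<^sup>2" by (intro mult_right_mono) auto
      then show ?thesis using N m \<epsilon>
        by (simp add: \<delta>_def field_simps flip: power_mult power_add)
    qed
    ultimately have "2 / 3 \<le> measure_pmf.prob \<Omega> D" by linarith
    also have "\<dots> = measure_pmf.prob \<Omega> (D \<inter> set_pmf \<Omega>)" by (simp add: measure_Int_set_pmf)
    also have "\<dots> \<le> measure_pmf.prob \<Omega> (P -` ?good \<inter> space (measure_pmf \<Omega>))"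
    proof (rule measure_pmf.finite_measure_mono)
      show "D \<inter> set_pmf \<Omega> \<subseteq> P -` ?good \<inter> space (measure_pmf \<Omega>)"
      proof
        fix s assume s: "s \<in> D \<inter> set_pmf \<Omega>"
        then have len: "length s = m" by (simp add: \<Omega>_def set_replicate_pmf)
        define d where "d = N / m * sum_list (map (r p q) s) - (\<Sum>j<N. r p q j)"
        define V where "V = ((\<Sum>j<N. level N p j) + (\<Sum>j<N. level N q j)) / real N ^ 2
          - 2 / N ^ 3 * (\<Sum>j<N. level N p j * level N q j)"
        have "\<bar>d\<bar> \<le> \<delta>" using s by (simp add: D_def d_def)
        then have "2 / N ^ 3 * \<bar>d\<bar> \<le> 2 / N ^ 3 * \<delta>" by (intro mult_left_mono) auto
        also have "\<dots> = \<epsilon> / 2" using N by (simp add: \<delta>_def)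
        finally have 1: "\<bar>2 / N ^ 3 * d\<bar> \<le> \<epsilon> / 2" by (simp add: abs_mult)
        have 2: "\<bar>?I - V\<bar> \<le> \<epsilon> / 2"
          using expectation_Abs_levels[OF pq[unfolded U_def] N] N\<epsilon> unfolding V_def by simp
        have "run (P s) p q = V - 2 / N ^ 3 * d"
          unfolding P(2)[OF pq len] val_def V_def d_def by (simp add: algebra_simps)
        with 1 2 have "\<bar>run (P s) p q - ?I\<bar> \<le> \<epsilon>" by linarith
        then show "s \<in> P -` ?good \<inter> space (measure_pmf \<Omega>)" by (auto simp: M_def)
      qed
    qed simp
    also have "\<dots> = measure M ?good"
      unfolding M_def by (rule measure_distr[symmetric, OF meas]) (use good in \<open>simp add: M_def\<close>)
    finally show "2 / 3 \<le> measure M ?good" .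
  qed
  then have "R_shared \<epsilon> unit_borel unit_borel Abs \<le> worst_case_cost M"
    unfolding R_shared_def by (intro INF_lower) simp
  also have "\<dots> \<le> enat (w * (2 * (N div L) + 2 * m + 4))"
    unfolding worst_case_cost_def by (rule SUP_least) (auto simp: M_def P(1))
  finally show ?thesis .
qed

theorem theorem3p11:
  "(\<lambda>\<epsilon>. R_shared \<epsilon> unit_borel unit_borel Abs) \<in> soft_O (\<lambda>\<epsilon>. 1 / \<epsilon> powr (2/5))"
proof -
  have "ereal_of_enat (R_shared \<epsilon> unit_borel unit_borel Abs)
      \<le> ereal (16984 * (1 / \<epsilon> powr (2/5)) * log 2 (2 / \<epsilon>) ^ 1)" if "\<epsilon> \<in> {0<..<1}" for \<epsilon>
  proof -
    have \<epsilon>: "0 < \<epsilon>" "\<epsilon> < 1" using that by auto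
    define e where "e = \<epsilon> powr (2/5)"
    have e: "0 < e" "e \<le> 1" "\<epsilon> \<le> e"
      using \<epsilon> powr_mono'[of "2/5" 1 \<epsilon>] by (auto simp: e_def powr_le1)
    \<comment> \<open>The balance that fixes the exponent 2/5: with \<open>L / N\<close> of order
      \<open>e\<close> there are about \<open>1 / e\<close> breakpoints, and the sample size of
      order \<open>e ^ 4 / \<epsilon>\<^sup>2\<close> is then \<open>1 / e\<close> too.\<close>
    have e5: "e ^ 5 = \<epsilon>\<^sup>2"
      using \<epsilon> by (simp add: e_def powr_power powr_numeral)
    define l where "l = log 2 (2 / \<epsilon>)"
    have l: "l \<ge> 1" using \<epsilon> by (simp add: l_def le_log_iff field_simps)
    define N where "N = nat \<lceil>6 / \<epsilon>\<rceil>"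
    have "6 / \<epsilon> > 6" using \<epsilon> by (simp add: field_simps)
    then have Nb: "6 / \<epsilon> \<le> N" "N \<le> 6 / \<epsilon> + 1" "N > 0" unfolding N_def by linarith+
    have N8: "N \<le> 8 / \<epsilon>" using Nb(2) \<epsilon> by (simp add: field_simps)
    have N6: "6 / N \<le> \<epsilon>" using Nb \<epsilon> by (simp add: field_simps)
    have "6 \<le> N * \<epsilon>" using Nb \<epsilon> by (simp add: field_simps)
    also have "\<dots> \<le> N * e" using e by (intro mult_left_mono) auto
    finally have Ne: "1 \<le> N * e" by simp
    define L where "L = nat \<lceil>N * e\<rceil>"
    have Lb: "N * e \<le> L" "L \<le> N * e + 1" "L > 0" using Ne unfolding L_def by linarith+
    \<comment> \<open>Since \<open>N * e\<close> is at least 1, rounding it up at most doubles it.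
      The fourth power of this 2, times 48, is the constant 768 in \<open>m\<close>.\<close>
    have "L / N \<le> 2 * e" using Lb(2) Ne Nb(3) by (simp add: field_simps)
    then have "(L / N) ^ 4 \<le> (2 * e) ^ 4" by (intro power_mono) auto
    then have L4: "(L / N) ^ 4 \<le> 16 * e ^ 4" by (simp add: power_mult_distrib)
    define m where "m = nat \<lceil>768 / e\<rceil>"
    have "768 / e > 0" using e by simp
    then have mb: "768 / e \<le> m" "m \<le> 768 / e + 1" "m > 0" unfolding m_def by linarith+
    have "48 * (L / N) ^ 4 \<le> 768 * e ^ 4" using L4 by simp
    also have "\<dots> = 768 / e * \<epsilon>\<^sup>2" unfolding e5[symmetric] using e by (simp add: eval_nat_numeral)
    also have "\<dots> \<le> m * \<epsilon>\<^sup>2" using mb by (intro mult_right_mono) auto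
    finally have m48: "48 * (L / N) ^ 4 \<le> m * \<epsilon>\<^sup>2" .
    \<comment> \<open>\<open>N\<close> is at most \<open>8 / \<epsilon> = 2 powr (2 + l)\<close>, so
      \<open>N ^ 3\<close> is at most \<open>2 powr x\<close>; the extra 1 in \<open>w\<close> makes
      the inequality strict.\<close>
    define x where "x = 3 * (2 + l)"
    define w where "w = nat \<lceil>x\<rceil> + 1"
    have "x > 0" using l by (simp add: x_def)
    then have "x < w" "w \<le> x + 2" unfolding w_def by linarith+
    then have wb: "3 * (2 + l) < w" "w \<le> 3 * (2 + l) + 2" by (simp_all add: x_def)
    have "2 powr l = 2 / \<epsilon>" using \<epsilon> by (simp add: l_def)
    then have "8 / \<epsilon> = 2 powr (2 + l)" by (simp add: powr_add)
    then have "real N ^ 3 \<le> (2 powr (2 + l)) ^ 3" using N8 by (intro power_mono) auto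
    also have "\<dots> = 2 powr (3 * (2 + l))" by (simp add: powr_power mult.commute)
    also have "\<dots> < 2 powr w" using wb by (intro powr_less_mono) auto
    also have "\<dots> = 2 ^ w" by (simp add: powr_realpow)
    finally have "real (N ^ 3) < real (2 ^ w)" by simp
    then have w: "N ^ 3 < 2 ^ w" by (simp only: of_nat_less_iff)
    have "real (N div L) \<le> N / L" by (rule of_nat_div_le_of_nat)
    also have "\<dots> \<le> 1 / e" using Lb e by (simp add: field_simps)
    finally have K: "real (N div L) \<le> 1 / e" .
    have "1 \<le> 1 / e" using e by simp
    \<comment> \<open>The bound is \<open>2 / e + 2 * (768 / e + 1) + 4\<close>, whose constant
      terms are absorbed by \<open>1 \<le> 1 / e\<close>. Likewise
      \<open>8 + 3 * l \<le> 11 * l\<close>, and 11 times 1544 is 16984.\<close>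
    then have "real (2 * (N div L) + 2 * m + 4) \<le> 1544 * (1 / e)"
      using K mb(2) by simp
    moreover have "real w \<le> 11 * l" using wb l by simp
    ultimately have "real w * real (2 * (N div L) + 2 * m + 4) \<le> 11 * l * (1544 * (1 / e))"
      by (intro mult_mono) (use l in auto)
    then have "real (w * (2 * (N div L) + 2 * m + 4)) \<le> 16984 * (1 / e) * l ^ 1"
      by (simp only: of_nat_mult power_one_right) (simp add: mult_ac)
    moreover have "ereal_of_enat (R_shared \<epsilon> unit_borel unit_borel Abs)
        \<le> ereal_of_enat (enat (w * (2 * (N div L) + 2 * m + 4)))"
      using R_shared_Abs_le[OF Nb(3) Lb(3) mb(3) w \<epsilon>(1) N6 m48] by (simp only: ereal_of_enat_le_iff)
    ultimately show ?thesis
      unfolding e_def l_def by (metis ereal_of_enat_simps(1) ereal_less_eq(3) order_trans)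
  qed
  then show ?thesis unfolding soft_O_def by blast
qed

end
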